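(* (1) For every integer $n\ge 1$, the Queen graph $Q_n$ of size $n$ satisfies $\alpha_{\mathrm{od}}(Q_n)=1$. (2) Consequently, for every integer $n\geq 1$, $\chi_{\mathrm{so}}(Q_n)=n^2$. (3) Moreover, every odd independent set of the infinite Queen graph, on the board $\mathbb{N}\times\mathbb{N}$ as well as on the board $\mathbb{Z}\times\mathbb{Z}$, is empty, a singleton, or infinite.
   Context: Here $\mathbb{N}=\{1,2,3,\ldots\}$. The Queen graph on a board $B\subseteq\mathbb{Z}\times\mathbb{Z}$ has vertex set $B$, and two distinct vertices $(a,b),(a',b')$ are adjacent iff $a=a'$, or $b=b'$, or $a-a'=b-b'$, or $a-a'=b'-b$. The Queen graph $Q_n$ of size $n$ is the one on $\{1,\ldots,n\}\times\{1,\ldots,n\}$; the infinite Queen graph is the one on $\mathbb{N}\times\mathbb{N}$ or on $\mathbb{Z}\times\mathbb{Z}$. For a graph $G=(V,E)$, $N(v)$ denotes the open neighborhood of $v$. A set $S\subseteq V$ is an odd independent set if it is independent and, for every vertex $v\in V\setminus S$, the set $N(v)\cap S$ is empty or of odd size. The odd independence number $\alpha_{\mathrm{od}}(G)$ is the largest size of an odd independent set of $G$. A proper vertex coloring of $G$ is a strong odd coloring if, for every vertex $v$, each color occurring in $N(v)$ occurs on an odd number of vertices of $N(v)$. The strong odd chromatic number $\chi_{\mathrm{so}}(G)$ is the least number of colors in a strong odd coloring of $G$. *)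

theory Defs
  imports Main
begin

text \<open>Simple graphs: a vertex set together with an adjacency relation on it.\<close>

record 'v graph =
  verts :: "'v set"
  adj :: "'v \<Rightarrow> 'v \<Rightarrow> bool"

definition simple_graph :: "'v graph \<Rightarrow> bool" where
  "simple_graph G \<longleftrightarrow>
     (\<forall>u v. adj G u v \<longrightarrow> u \<in> verts G \<and> v \<in> verts G \<and> u \<noteq> v \<and> adj G v u)"

definition nbhd :: "'v graph \<Rightarrow> 'v \<Rightarrow> 'v set" where
  "nbhd G v = {u \<in> verts G. adj G v u}"

definition independent_set :: "'v graph \<Rightarrow> 'v set \<Rightarrow> bool" where
  "independent_set G S \<longleftrightarrow> S \<subseteq> verts G \<and> (\<forall>u\<in>S. \<forall>v\<in>S. \<not> adj G u v)"

text \<open>Since \<open>card\<close> is \<open>0\<close> on infinite sets, \<open>odd (card X)\<close> entails that \<open>X\<close> is finite.\<close>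

definition odd_independent_set :: "'v graph \<Rightarrow> 'v set \<Rightarrow> bool" where
  "odd_independent_set G S \<longleftrightarrow> independent_set G S \<and>
     (\<forall>v \<in> verts G - S. nbhd G v \<inter> S = {} \<or> odd (card (nbhd G v \<inter> S)))"

text \<open>The next number is meaningful for finite graphs only (\<open>Max\<close> of a finite nonempty set).\<close>

definition odd_independence_number :: "'v graph \<Rightarrow> nat" where
  "odd_independence_number G = Max {card S | S. odd_independent_set G S}"

definition proper_coloring :: "'v graph \<Rightarrow> ('v \<Rightarrow> 'c) \<Rightarrow> bool" where
  "proper_coloring G c \<longleftrightarrow> (\<forall>u\<in>verts G. \<forall>v\<in>verts G. adj G u v \<longrightarrow> c u \<noteq> c v)"

definition strong_odd_coloring :: "'v graph \<Rightarrow> ('v \<Rightarrow> 'c) \<Rightarrow> bool" where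
  "strong_odd_coloring G c \<longleftrightarrow> proper_coloring G c \<and>
     (\<forall>v\<in>verts G. \<forall>k \<in> c ` nbhd G v. odd (card {u \<in> nbhd G v. c u = k}))"

text \<open>
  Colors are taken from \<open>{..<k}\<close>. For a finite graph a suitable \<open>k\<close> exists, because an
  injective coloring is a strong odd coloring; so \<open>LEAST\<close> is well defined there.
\<close>

definition strong_odd_chromatic_number :: "'v graph \<Rightarrow> nat" where
  "strong_odd_chromatic_number G =
     (LEAST k. \<exists>c :: 'v \<Rightarrow> nat. c ` verts G \<subseteq> {..<k} \<and> strong_odd_coloring G c)"

definition queen_adj :: "int \<times> int \<Rightarrow> int \<times> int \<Rightarrow> bool" where
  "queen_adj = (\<lambda>(a, b) (a', b'). (a, b) \<noteq> (a', b') \<and>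
     (a = a' \<or> b = b' \<or> a - a' = b - b' \<or> a - a' = b' - b))"

definition queen_graph :: "(int \<times> int) set \<Rightarrow> (int \<times> int) graph" where
  "queen_graph B = \<lparr>verts = B, adj = (\<lambda>u v. u \<in> B \<and> v \<in> B \<and> queen_adj u v)\<rparr>"

definition square_board :: "nat \<Rightarrow> (int \<times> int) set" where
  "square_board n = {1..int n} \<times> {1..int n}"

lemma simple_graph_queen_graph: "simple_graph (queen_graph B)"
  by (auto simp: simple_graph_def queen_graph_def queen_adj_def)

end

theory Submission
  imports Defs
begin

text \<open>
  Let \<open>S\<close> be a finite odd independent set with bounding box \<open>[0, w] \<times> [0, h]\<close>. A cell of the box
  outside \<open>S\<close> lies on 0, 1 or 3 occupied lines (column, row, diagonal, antidiagonal). Hence on the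
  bottom side the occupied diagonals and antidiagonals through a cell number at least one if its
  column is occupied, and two at the queen, giving at least \<open>|S| + 1\<close> incidences; the same holds
  for the other three sides. A slanted line meets the two shorter sides at most once in total,
  except that for \<open>w = h\<close> the two main diagonals meet both; this forces \<open>w = h\<close> and equality in
  all these bounds. So the occupied lines are related by four reflection identities, one for each
  side (\<open>bottom_eq\<close>, \<open>top_eq\<close>, \<open>left_eq\<close>, \<open>right_eq\<close>), and \<open>|S|\<close> is odd.

  Unless \<open>w = 0\<close>, the parity condition along the two main diagonals then shows that \<open>w = 2c\<close> is even,
  that the centre \<open>(c, c)\<close> is a queen, and that the occupied lines of even index are symmetric
  about the centre. If \<open>c\<close> is even, counting odd columns leaves no room for both queens on the
  left and right sides. If \<open>c\<close> is odd, the indices divisible by 4 of the occupied diagonals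
  are closed under addition inside the box; the queen on the extreme such diagonal must then be the
  centre, so even columns and rows are occupied only on the sides of the box, which contradicts
  the identity at the foot of the middle column.

  Part (2) follows since the classes of a strong odd coloring are odd independent sets.
\<close>

section \<open>Counting queens on lines\<close>

text \<open>The map \<open>f\<close> selects a family of lines: \<open>fst\<close> columns,
  \<open>snd\<close> rows, difference and sum of the coordinates diagonals and antidiagonals. Values
  are integers so that identities can be subtracted.\<close>

definition hits :: "(int \<times> int) set \<Rightarrow> (int \<times> int \<Rightarrow> int) \<Rightarrow> int \<Rightarrow> int" where
  "hits S f t = (\<Sum>s\<in>S. of_bool (f s = t))"

lemma hits_eq_of_bool:
  assumes "finite S" "inj_on f S"
  shows "hits S f t = of_bool (t \<in> f ` S)"
proof (cases "t \<in> f ` S")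
  case True
  then obtain s0 where s0: "s0 \<in> S" "t = f s0" by blast
  have "hits S f t = (\<Sum>s\<in>S. if s = s0 then 1 else 0)"
    unfolding hits_def using s0 assms(2) by (intro sum.cong) (auto dest: inj_onD)
  then show ?thesis using s0 assms(1) True by simp
next
  case False
  then have "hits S f t = (\<Sum>s\<in>S. 0)"
    unfolding hits_def by (intro sum.cong) auto
  then show ?thesis using False by simp
qed

text \<open>Double counting: after swapping the sums, a queen \<open>s\<close> contributes only at
  the index \<open>u s\<close>, and only if \<open>P s\<close>. The weight is 1 for counts and the
  identity for first moments.\<close>

lemma sum_hits:
  assumes "finite S" "finite T"
    and "\<And>s t. s \<in> S \<Longrightarrow> t \<in> T \<Longrightarrow> f s = g t \<longleftrightarrow> P s \<and> t = u s"
    and "\<And>s. s \<in> S \<Longrightarrow> P s \<Longrightarrow> u s \<in> T"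
  shows "(\<Sum>t\<in>T. \<phi> t * hits S f (g t)) = (\<Sum>s\<in>S. of_bool (P s) * \<phi> (u s))"
proof -
  have "(\<Sum>t\<in>T. \<phi> t * hits S f (g t)) = (\<Sum>t\<in>T. \<Sum>s\<in>S. \<phi> t * of_bool (f s = g t))"
    by (simp add: hits_def sum_distrib_left)
  also have "\<dots> = (\<Sum>s\<in>S. \<Sum>t\<in>T. \<phi> t * of_bool (f s = g t))"
    by (rule sum.swap)
  also have "\<dots> = (\<Sum>s\<in>S. of_bool (P s) * \<phi> (u s))"
  proof (rule sum.cong[OF refl])
    fix s assume s: "s \<in> S"
    have "(\<Sum>t\<in>T. \<phi> t * of_bool (f s = g t)) = (\<Sum>t\<in>T. if t = u s then of_bool (P s) * \<phi> t else 0)"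
      using assms(3)[OF s] by (intro sum.cong) auto
    also have "\<dots> = of_bool (P s) * \<phi> (u s)"
      using assms(2) assms(4)[OF s] by (auto simp: sum.delta)
    finally show "(\<Sum>t\<in>T. \<phi> t * of_bool (f s = g t)) = of_bool (P s) * \<phi> (u s)" .
  qed
  finally show ?thesis .
qed

lemmas sum_hits_1 = sum_hits[where \<phi> = "\<lambda>_. 1", simplified]

lemma sum_of_bool_eq:
  assumes "finite A" "q \<in> A"
  shows "(\<Sum>x\<in>A. of_bool (x = q) :: int) = 1"
  unfolding of_bool_def using assms by simp

section \<open>The bounding box and the inequalities on its sides\<close>

text \<open>The queens on the bottom, top, left and right side of the bounding box are \<open>(qb, 0)\<close>,
  \<open>(qt, h)\<close>, \<open>(0, ql)\<close> and \<open>(w, qr)\<close>; at a corner, two of them coincide.\<close>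

locale queen_box =
  fixes S :: "(int \<times> int) set" and w h qb qt ql qr :: int
  assumes finite_S: "finite S"
    and in_box: "(x, y) \<in> S \<Longrightarrow> 0 \<le> x \<and> x \<le> w \<and> 0 \<le> y \<and> y \<le> h"
    and inj_fst: "inj_on fst S" and inj_snd: "inj_on snd S"
    and inj_diff: "inj_on (\<lambda>s. fst s - snd s) S"
    and inj_sum: "inj_on (\<lambda>s. fst s + snd s) S"
    and bottom: "(qb, 0) \<in> S" and top: "(qt, h) \<in> S"
    and left: "(0, ql) \<in> S" and right: "(w, qr) \<in> S"
    and cell: "\<lbrakk>0 \<le> x; x \<le> w; 0 \<le> y; y \<le> h; (x, y) \<notin> S\<rbrakk> \<Longrightarrow>
      hits S fst x + hits S snd y + hits S (\<lambda>s. fst s - snd s) (x - y)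
        + hits S (\<lambda>s. fst s + snd s) (x + y) \<in> {0, 1, 3}"
begin

abbreviation "col \<equiv> hits S fst"
abbreviation "row \<equiv> hits S snd"
abbreviation "dg \<equiv> hits S (\<lambda>s. fst s - snd s)"
abbreviation "ad \<equiv> hits S (\<lambda>s. fst s + snd s)"
abbreviation "m \<equiv> int (card S)"
abbreviation "num P \<equiv> (\<Sum>s\<in>S. of_bool (P s) :: int)"

lemma col_eq: "col x = of_bool (\<exists>y. (x, y) \<in> S)"
  unfolding hits_eq_of_bool[OF finite_S inj_fst] by force
lemma row_eq: "row y = of_bool (\<exists>x. (x, y) \<in> S)"
  unfolding hits_eq_of_bool[OF finite_S inj_snd] by force
lemma dg_eq: "dg k = of_bool (\<exists>x y. (x, y) \<in> S \<and> k = x - y)"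
  unfolding hits_eq_of_bool[OF finite_S inj_diff] by (rule arg_cong[where f = of_bool]) force
lemma ad_eq: "ad k = of_bool (\<exists>x y. (x, y) \<in> S \<and> k = x + y)"
  unfolding hits_eq_of_bool[OF finite_S inj_sum] by (rule arg_cong[where f = of_bool]) force

lemma dgE:
  assumes "dg k = 1" obtains x y where "(x, y) \<in> S" "k = x - y"
  using assms unfolding dg_eq of_bool_eq_1_iff by blast
lemma adE:
  assumes "ad k = 1" obtains x y where "(x, y) \<in> S" "k = x + y"
  using assms unfolding ad_eq of_bool_eq_1_iff by blast

lemma hits_bounds:
  "0 \<le> col x" "col x \<le> 1" "0 \<le> row x" "row x \<le> 1"
  "0 \<le> dg x" "dg x \<le> 1" "0 \<le> ad x" "ad x \<le> 1"
  by (simp_all add: col_eq row_eq dg_eq ad_eq)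

lemma queen_hits:
  assumes "(x, y) \<in> S"
  shows "col x = 1" "row y = 1" "dg (x - y) = 1" "ad (x + y) = 1"
  unfolding col_eq row_eq dg_eq ad_eq of_bool_eq_1_iff using assms by blast+

lemma same_col: "(x, y) \<in> S \<Longrightarrow> (x, y') \<in> S \<Longrightarrow> y = y'"
  using inj_onD[OF inj_fst, of "(x, y)" "(x, y')"] by simp
lemma same_row: "(x, y) \<in> S \<Longrightarrow> (x', y) \<in> S \<Longrightarrow> x = x'"
  using inj_onD[OF inj_snd, of "(x, y)" "(x', y)"] by simp
lemma same_dg: "(x, y) \<in> S \<Longrightarrow> (x', y') \<in> S \<Longrightarrow> x - y = x' - y' \<Longrightarrow> x = x' \<and> y = y'"
  using inj_onD[OF inj_diff, of "(x, y)" "(x', y')"] by simp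
lemma same_ad: "(x, y) \<in> S \<Longrightarrow> (x', y') \<in> S \<Longrightarrow> x + y = x' + y' \<Longrightarrow> x = x' \<and> y = y'"
  using inj_onD[OF inj_sum, of "(x, y)" "(x', y')"] by simp

lemma in_box': "s \<in> S \<Longrightarrow> 0 \<le> fst s \<and> fst s \<le> w \<and> 0 \<le> snd s \<and> snd s \<le> h"
  using in_box[of "fst s" "snd s"] by simp

lemma q_range: "qb \<in> {0..w}" "qt \<in> {0..w}" "ql \<in> {0..h}" "qr \<in> {0..h}"
  using in_box[OF bottom] in_box[OF top] in_box[OF left] in_box[OF right] by auto

lemma w_nonneg: "0 \<le> w" and h_nonneg: "0 \<le> h"
  using in_box[OF bottom] by auto

text \<open>Off the queen the bottom row is still occupied, so by \<open>cell\<close> the other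
  three lines through the cell have 0 or 2 occupied members; an occupied column thus needs a slanted
  partner. At the queen both slanted lines are occupied.\<close>

lemma bottom_le:
  assumes "x \<in> {0..w}"
  shows "col x + of_bool (x = qb) \<le> dg x + ad x"
proof (cases "(x, 0) \<in> S")
  case True
  then show ?thesis using queen_hits[OF True] by auto
next
  case False
  then show ?thesis
    using cell[of x 0] assms h_nonneg hits_bounds[of x] queen_hits(2)[OF bottom] bottom
    by (auto simp: of_bool_def)
qed

lemma top_le:
  assumes "x \<in> {0..w}"
  shows "col x + of_bool (x = qt) \<le> dg (x - h) + ad (x + h)"
proof (cases "(x, h) \<in> S")
  case True
  then show ?thesis using queen_hits[OF True] by auto
next
  case False
  then show ?thesis
    using cell[of x h] assms h_nonneg hits_bounds[of x] hits_bounds[of "x - h"]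
      hits_bounds[of "x + h"] queen_hits(2)[OF top] top
    by (auto simp: of_bool_def)
qed

lemma left_le:
  assumes "y \<in> {0..h}"
  shows "row y + of_bool (y = ql) \<le> dg (- y) + ad y"
proof (cases "(0, y) \<in> S")
  case True
  then show ?thesis using queen_hits[OF True] by auto
next
  case False
  then show ?thesis
    using cell[of 0 y] assms w_nonneg hits_bounds[of y] hits_bounds[of "- y"]
      queen_hits(1)[OF left] left
    by (auto simp: of_bool_def)
qed

lemma right_le:
  assumes "y \<in> {0..h}"
  shows "row y + of_bool (y = qr) \<le> dg (w - y) + ad (w + y)"
proof (cases "(w, y) \<in> S")
  case True
  then show ?thesis using queen_hits[OF True] by auto
next
  case False
  then show ?thesis
    using cell[of w y] assms w_nonneg hits_bounds[of y] hits_bounds[of "w - y"]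
      hits_bounds[of "w + y"] queen_hits(1)[OF right] right
    by (auto simp: of_bool_def)
qed

lemma sum_col: "(\<Sum>x\<in>{0..w}. col x) = m"
  by (subst sum_hits_1[where P = "\<lambda>_. True" and u = fst]) (auto simp: finite_S dest: in_box')
lemma sum_row: "(\<Sum>y\<in>{0..h}. row y) = m"
  by (subst sum_hits_1[where P = "\<lambda>_. True" and u = snd]) (auto simp: finite_S dest: in_box')

text \<open>The slanted lines of \<open>s\<close> reach height 0 at \<open>fst s - snd s\<close> and
  \<open>fst s + snd s\<close>; the right-hand conditions say that these points lie in the
  box.\<close>

lemma sum_bottom: "(\<Sum>x\<in>{0..w}. dg x) = num (\<lambda>s. snd s \<le> fst s)"
   "(\<Sum>x\<in>{0..w}. ad x) = num (\<lambda>s. fst s + snd s \<le> w)"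
   apply (rule sum_hits_1[where u = "\<lambda>s. fst s - snd s"]; auto simp: finite_S dest: in_box')
   apply (rule sum_hits_1[where u = "\<lambda>s. fst s + snd s"]; auto simp: finite_S dest: in_box')
  done

lemma sum_top: "(\<Sum>x\<in>{0..w}. dg (x - h)) = num (\<lambda>s. fst s - snd s \<le> w - h)"
   "(\<Sum>x\<in>{0..w}. ad (x + h)) = num (\<lambda>s. h \<le> fst s + snd s)"
   apply (rule sum_hits_1[where u = "\<lambda>s. fst s - snd s + h"]; auto simp: finite_S dest: in_box')
   apply (rule sum_hits_1[where u = "\<lambda>s. fst s + snd s - h"]; auto simp: finite_S dest: in_box')
  done

lemma sum_left: "(\<Sum>y\<in>{0..h}. dg (- y)) = num (\<lambda>s. fst s \<le> snd s)"
   "(\<Sum>y\<in>{0..h}. ad y) = num (\<lambda>s. fst s + snd s \<le> h)"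
   apply (rule sum_hits_1[where u = "\<lambda>s. snd s - fst s"]; auto simp: finite_S dest: in_box')
   apply (rule sum_hits_1[where u = "\<lambda>s. fst s + snd s"]; auto simp: finite_S dest: in_box')
  done

lemma sum_right: "(\<Sum>y\<in>{0..h}. dg (w - y)) = num (\<lambda>s. w - h \<le> fst s - snd s)"
   "(\<Sum>y\<in>{0..h}. ad (w + y)) = num (\<lambda>s. w \<le> fst s + snd s)"
   apply (rule sum_hits_1[where u = "\<lambda>s. w - fst s + snd s"]; auto simp: finite_S dest: in_box')
   apply (rule sum_hits_1[where u = "\<lambda>s. fst s + snd s - w"]; auto simp: finite_S dest: in_box')
  done

lemma num_add_le:
  assumes "\<And>s. s \<in> S \<Longrightarrow> \<not> (P s \<and> Q s)"
  shows "num P + num Q \<le> m"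
proof -
  have "num P + num Q \<le> (\<Sum>s\<in>S. 1)"
    unfolding sum.distrib[symmetric] using assms by (intro sum_mono) auto
  then show ?thesis by simp
qed

lemma bottom_count_le: "m + 1 \<le> num (\<lambda>s. snd s \<le> fst s) + num (\<lambda>s. fst s + snd s \<le> w)"
proof -
  have "m + 1 = (\<Sum>x\<in>{0..w}. col x + of_bool (x = qb))"
    by (simp only: sum.distrib sum_col sum_of_bool_eq[OF finite_atLeastAtMost_int q_range(1)])
  also have "\<dots> \<le> (\<Sum>x\<in>{0..w}. dg x + ad x)" by (intro sum_mono bottom_le)
  finally show ?thesis unfolding sum.distrib sum_bottom .
qed

lemma top_count_le: "m + 1 \<le> num (\<lambda>s. fst s - snd s \<le> w - h) + num (\<lambda>s. h \<le> fst s + snd s)"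
proof -
  have "m + 1 = (\<Sum>x\<in>{0..w}. col x + of_bool (x = qt))"
    by (simp only: sum.distrib sum_col sum_of_bool_eq[OF finite_atLeastAtMost_int q_range(2)])
  also have "\<dots> \<le> (\<Sum>x\<in>{0..w}. dg (x - h) + ad (x + h))" by (intro sum_mono top_le)
  finally show ?thesis unfolding sum.distrib sum_top .
qed

lemma left_count_le: "m + 1 \<le> num (\<lambda>s. fst s \<le> snd s) + num (\<lambda>s. fst s + snd s \<le> h)"
proof -
  have "m + 1 = (\<Sum>y\<in>{0..h}. row y + of_bool (y = ql))"
    by (simp only: sum.distrib sum_row sum_of_bool_eq[OF finite_atLeastAtMost_int q_range(3)])
  also have "\<dots> \<le> (\<Sum>y\<in>{0..h}. dg (- y) + ad y)" by (intro sum_mono left_le)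
  finally show ?thesis unfolding sum.distrib sum_left .
qed

lemma right_count_le: "m + 1 \<le> num (\<lambda>s. w - h \<le> fst s - snd s) + num (\<lambda>s. w \<le> fst s + snd s)"
proof -
  have "m + 1 = (\<Sum>y\<in>{0..h}. row y + of_bool (y = qr))"
    by (simp only: sum.distrib sum_row sum_of_bool_eq[OF finite_atLeastAtMost_int q_range(4)])
  also have "\<dots> \<le> (\<Sum>y\<in>{0..h}. dg (w - y) + ad (w + y))" by (intro sum_mono right_le)
  finally show ?thesis unfolding sum.distrib sum_right .
qed

text \<open>If \<open>w < h\<close>, no slanted line meets both the bottom and the top side, so the
  two counts add up to at most \<open>2 * m\<close>, against the lower bound
  \<open>2 * m + 2\<close>. For \<open>h < w\<close> the left and right sides serve instead.\<close>

lemma w_eq_h: "w = h"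
proof (rule ccontr)
  assume "w \<noteq> h"
  then consider "w < h" | "h < w" by linarith
  then show False
  proof cases
    case 1
    then show False
      using bottom_count_le top_count_le num_add_le[of "\<lambda>s. snd s \<le> fst s" "\<lambda>s. fst s - snd s \<le> w - h"]
        num_add_le[of "\<lambda>s. fst s + snd s \<le> w" "\<lambda>s. h \<le> fst s + snd s"] by force
  next
    case 2
    then show False
      using left_count_le right_count_le num_add_le[of "\<lambda>s. fst s \<le> snd s" "\<lambda>s. w - h \<le> fst s - snd s"]
        num_add_le[of "\<lambda>s. fst s + snd s \<le> h" "\<lambda>s. w \<le> fst s + snd s"] by force
  qed
qed

end


section \<open>Parity arithmetic\<close>

lemma parity_reflect:
  fixes u v u' v' k x x' z z' :: int
  assumes "u + v + u' + v' = 2 * k" "even (u + v + x + z)" "even (u' + v' + x' + z')"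
  shows "even (x + z + (x' + z'))"
proof -
  have "x + z + (x' + z') = (u + v + x + z) + (u' + v' + x' + z') - 2 * k"
    using assms(1) by simp
  then show ?thesis using assms(2,3) by (metis dvd_add dvd_diff dvd_triv_left)
qed

lemma eq_of_parity:
  fixes x y z :: int
  shows "even (x + z + (y + z)) \<Longrightarrow> 0 \<le> x \<Longrightarrow> x \<le> 1 \<Longrightarrow> 0 \<le> y \<Longrightarrow> y \<le> 1 \<Longrightarrow> y = x"
  by presburger

lemma zero_of_even:
  fixes x y z :: int
  shows "even (x + y + z) \<Longrightarrow> x = y \<Longrightarrow> 0 \<le> z \<Longrightarrow> z \<le> 1 \<Longrightarrow> z = 0"
  by presburger

lemma even_of_even_add: "even (n + 1 + k) \<Longrightarrow> odd n \<Longrightarrow> even k" for n k :: int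
  by presburger

lemma zero_or_odd_le_4:
  fixes n :: int
  shows "n = 0 \<or> odd n \<Longrightarrow> 0 \<le> n \<Longrightarrow> n \<le> 4 \<Longrightarrow> n \<in> {0, 1, 3}"
  unfolding insert_iff empty_iff by presburger

lemma even_of_cell:
  fixes i j k :: int
  assumes "i + j + 1 + k \<in> {0, 1, 3}" "0 \<le> i" "0 \<le> j" "0 \<le> k"
  shows "even (i + j + k)"
proof -
  have "i + j + k = 0 \<or> i + j + k = 2" using assms by simp linarith
  then show ?thesis by presburger
qed

lemma parity_clash:
  "even (k + k + b + 1) \<Longrightarrow> a + b = k \<Longrightarrow> odd a \<Longrightarrow> 2 * c = k + 1 \<Longrightarrow> False" for a b c k :: int
  by presburger

text \<open>Pairing \<open>i\<close> with \<open>2 * n - i\<close> leaves the fixed point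
  \<open>n\<close>, which is then counted twice.\<close>

lemma even_sum_symmetric:
  fixes f :: "int \<Rightarrow> int"
  assumes "0 \<le> n" and "\<And>i. i \<in> {0..2 * n} \<Longrightarrow> even (f i + f (2 * n - i))"
  shows "even ((\<Sum>i\<in>{0..2 * n}. f i) + f n)"
proof -
  have split: "{0..2 * n} = {0..<n} \<union> insert n {n<..2 * n}" using assms(1) by auto
  have "(\<Sum>i\<in>{0..2 * n}. f i) = (\<Sum>i\<in>{0..<n}. f i) + (f n + (\<Sum>i\<in>{n<..2 * n}. f i))"
    unfolding split by (subst sum.union_disjoint) auto
  also have "(\<Sum>i\<in>{n<..2 * n}. f i) = (\<Sum>i\<in>{0..<n}. f (2 * n - i))"
    by (rule sum.reindex_bij_witness[of _ "\<lambda>i. 2 * n - i" "\<lambda>i. 2 * n - i"]) auto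
  finally have "(\<Sum>i\<in>{0..2 * n}. f i) + f n
      = (\<Sum>i\<in>{0..<n}. f i + f (2 * n - i)) + 2 * f n"
    by (simp add: sum.distrib)
  moreover have "even (\<Sum>i\<in>{0..<n}. f i + f (2 * n - i))"
    by (intro dvd_sum assms(2)) auto
  ultimately show ?thesis by simp
qed

section \<open>The square box: equality on all sides and parity along the main diagonals\<close>

locale queen_square = queen_box S w w qb qt ql qr for S w qb qt ql qr +
  assumes w_pos: "0 < w"
begin

lemma num_diff: "num (\<lambda>s. snd s \<le> fst s) + num (\<lambda>s. fst s \<le> snd s) = m + dg 0"
proof -
  have "num (\<lambda>s. snd s \<le> fst s) + num (\<lambda>s. fst s \<le> snd s)
      = (\<Sum>s\<in>S. 1 + of_bool (fst s - snd s = 0))"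
    unfolding sum.distrib[symmetric] by (intro sum.cong) auto
  then show ?thesis by (simp add: sum.distrib hits_def)
qed

lemma num_sum: "num (\<lambda>s. fst s + snd s \<le> w) + num (\<lambda>s. w \<le> fst s + snd s) = m + ad w"
proof -
  have "num (\<lambda>s. fst s + snd s \<le> w) + num (\<lambda>s. w \<le> fst s + snd s)
      = (\<Sum>s\<in>S. 1 + of_bool (fst s + snd s = w))"
    unfolding sum.distrib[symmetric] by (intro sum.cong) auto
  then show ?thesis by (simp add: sum.distrib hits_def)
qed

text \<open>The bottom and top counts sum to \<open>2 * m + dg 0 + ad w\<close> and to at least
  \<open>2 * m + 2\<close>, so both main diagonals are occupied and both bounds are tight. The same
  holds for left and right; comparing the four tight bounds makes all four half counts
  equal.\<close>

lemma dg_0: "dg 0 = 1" and ad_w: "ad w = 1"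
  and count_dg: "2 * num (\<lambda>s. snd s \<le> fst s) = m + 1" "2 * num (\<lambda>s. fst s \<le> snd s) = m + 1"
  and count_ad: "2 * num (\<lambda>s. fst s + snd s \<le> w) = m + 1" "2 * num (\<lambda>s. w \<le> fst s + snd s) = m + 1"
  using bottom_count_le top_count_le left_count_le right_count_le num_diff num_sum
    hits_bounds[of 0] hits_bounds[of w]
  unfolding diff_self diff_le_0_iff_le diff_ge_0_iff_ge by linarith+

text \<open>The inequality \<open>bottom_le\<close> holds termwise and the totals agree by
  \<open>count_dg\<close> and \<open>count_ad\<close>, so each term is an equality. The other three
  sides are treated alike.\<close>

lemma bottom_eq: "x \<in> {0..w} \<Longrightarrow> col x + of_bool (x = qb) = dg x + ad x"
proof (rule sum_mono_inv[OF _ bottom_le])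
  show "(\<Sum>x\<in>{0..w}. col x + of_bool (x = qb)) = (\<Sum>x\<in>{0..w}. dg x + ad x)"
    using count_dg count_ad unfolding sum.distrib sum_bottom sum_col sum_of_bool_eq[OF finite_atLeastAtMost_int q_range(1)]
      diff_self diff_le_0_iff_le diff_ge_0_iff_ge by linarith
qed auto

lemma top_eq: "x \<in> {0..w} \<Longrightarrow> col x + of_bool (x = qt) = dg (x - w) + ad (x + w)"
proof (rule sum_mono_inv[OF _ top_le])
  show "(\<Sum>x\<in>{0..w}. col x + of_bool (x = qt)) = (\<Sum>x\<in>{0..w}. dg (x - w) + ad (x + w))"
    using count_dg count_ad unfolding sum.distrib sum_top sum_col sum_of_bool_eq[OF finite_atLeastAtMost_int q_range(2)]
      diff_self diff_le_0_iff_le diff_ge_0_iff_ge by linarith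
qed auto

lemma left_eq: "y \<in> {0..w} \<Longrightarrow> row y + of_bool (y = ql) = dg (- y) + ad y"
proof (rule sum_mono_inv[OF _ left_le])
  show "(\<Sum>y\<in>{0..w}. row y + of_bool (y = ql)) = (\<Sum>y\<in>{0..w}. dg (- y) + ad y)"
    using count_dg count_ad unfolding sum.distrib sum_left sum_row sum_of_bool_eq[OF finite_atLeastAtMost_int q_range(3)]
      diff_self diff_le_0_iff_le diff_ge_0_iff_ge by linarith
qed auto

lemma right_eq: "y \<in> {0..w} \<Longrightarrow> row y + of_bool (y = qr) = dg (w - y) + ad (w + y)"
proof (rule sum_mono_inv[OF _ right_le])
  show "(\<Sum>y\<in>{0..w}. row y + of_bool (y = qr)) = (\<Sum>y\<in>{0..w}. dg (w - y) + ad (w + y))"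
    using count_dg count_ad unfolding sum.distrib sum_right sum_row sum_of_bool_eq[OF finite_atLeastAtMost_int q_range(4)]
      diff_self diff_le_0_iff_le diff_ge_0_iff_ge by linarith
qed auto

text \<open>Both this and its companion \<open>ql_qr\<close> come from comparing first moments in the identities for two
  opposite sides.\<close>

lemma qb_qt: "qb + qt = w"
proof -
  have "(\<Sum>x\<in>{0..w}. x * (col x + of_bool (x = qb)) + x * (col x + of_bool (x = qt)))
      = (\<Sum>x\<in>{0..w}. x * (dg x + ad x) + x * (dg (x - w) + ad (x + w)))"
    by (intro sum.cong) (auto simp: bottom_eq top_eq)
  then have *: "(\<Sum>x\<in>{0..w}. x * col x) + (\<Sum>x\<in>{0..w}. x * of_bool (x = qb))
      + ((\<Sum>x\<in>{0..w}. x * col x) + (\<Sum>x\<in>{0..w}. x * of_bool (x = qt)))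
     = (\<Sum>x\<in>{0..w}. x * dg x) + (\<Sum>x\<in>{0..w}. x * ad x)
      + ((\<Sum>x\<in>{0..w}. x * dg (x - w)) + (\<Sum>x\<in>{0..w}. x * ad (x + w)))"
    unfolding sum.distrib distrib_left .
  have q: "(\<Sum>x\<in>{0..w}. x * of_bool (x = q)) = q" if "(q, y) \<in> S" for q y
    using in_box[OF that] by (simp add: of_bool_def if_distrib cong: if_cong)
  have c: "(\<Sum>x\<in>{0..w}. x * col x) = (\<Sum>s\<in>S. of_bool True * fst s)"
    by (rule sum_hits) (auto simp: finite_S dest: in_box')
  have b1: "(\<Sum>x\<in>{0..w}. x * dg x) = (\<Sum>s\<in>S. of_bool (snd s \<le> fst s) * (fst s - snd s))"
    by (rule sum_hits) (auto simp: finite_S dest: in_box')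
  have b2: "(\<Sum>x\<in>{0..w}. x * ad x) = (\<Sum>s\<in>S. of_bool (fst s + snd s \<le> w) * (fst s + snd s))"
    by (rule sum_hits) (auto simp: finite_S dest: in_box')
  have t1: "(\<Sum>x\<in>{0..w}. x * dg (x - w)) = (\<Sum>s\<in>S. of_bool (fst s \<le> snd s) * (fst s - snd s + w))"
    by (rule sum_hits) (auto simp: finite_S dest: in_box')
  have t2: "(\<Sum>x\<in>{0..w}. x * ad (x + w)) = (\<Sum>s\<in>S. of_bool (w \<le> fst s + snd s) * (fst s + snd s - w))"
    by (rule sum_hits) (auto simp: finite_S dest: in_box')
  \<comment> \<open>Per queen, the slanted lines contribute difference plus sum of the coordinates,
    that is \<open>2 * fst s\<close>, up to shifts by \<open>w\<close> for hits on the top side. The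
    last summand corrects antidiagonal \<open>w\<close>, which meets both sides. The two shift
    totals cancel because the half counts are equal.\<close>
  have "(\<Sum>s\<in>S. of_bool (snd s \<le> fst s) * (fst s - snd s)) + (\<Sum>s\<in>S. of_bool (fst s + snd s \<le> w) * (fst s + snd s))
     + (\<Sum>s\<in>S. of_bool (fst s \<le> snd s) * (fst s - snd s + w)) + (\<Sum>s\<in>S. of_bool (w \<le> fst s + snd s) * (fst s + snd s - w))
     = (\<Sum>s\<in>S. 2 * fst s + w * of_bool (fst s \<le> snd s) - w * of_bool (w \<le> fst s + snd s) + w * of_bool (fst s + snd s = w))"
    unfolding sum.distrib[symmetric] by (intro sum.cong) (auto simp: of_bool_def)
  also have "\<dots> = 2 * (\<Sum>s\<in>S. fst s) + w * num (\<lambda>s. fst s \<le> snd s) - w * num (\<lambda>s. w \<le> fst s + snd s) + w * ad w"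
    by (simp add: sum.distrib sum_subtractf sum_distrib_left[symmetric] hits_def)
  also have "\<dots> = 2 * (\<Sum>s\<in>S. fst s) + w"
    using count_dg count_ad by (simp add: ad_w)
  finally show ?thesis
    using * unfolding q[OF bottom] q[OF top] c b1 b2 t1 t2 by simp
qed

lemma ql_qr: "ql + qr = w"
proof -
  have "(\<Sum>y\<in>{0..w}. y * (row y + of_bool (y = ql)) + y * (row y + of_bool (y = qr)))
      = (\<Sum>y\<in>{0..w}. y * (dg (- y) + ad y) + y * (dg (w - y) + ad (w + y)))"
    by (intro sum.cong) (auto simp: left_eq right_eq)
  then have *: "(\<Sum>y\<in>{0..w}. y * row y) + (\<Sum>y\<in>{0..w}. y * of_bool (y = ql))
      + ((\<Sum>y\<in>{0..w}. y * row y) + (\<Sum>y\<in>{0..w}. y * of_bool (y = qr)))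
     = (\<Sum>y\<in>{0..w}. y * dg (- y)) + (\<Sum>y\<in>{0..w}. y * ad y)
      + ((\<Sum>y\<in>{0..w}. y * dg (w - y)) + (\<Sum>y\<in>{0..w}. y * ad (w + y)))"
    unfolding sum.distrib distrib_left .
  have q: "(\<Sum>y\<in>{0..w}. y * of_bool (y = q)) = q" if "(x, q) \<in> S" for q x
    using in_box[OF that] by (simp add: of_bool_def if_distrib cong: if_cong)
  have c: "(\<Sum>y\<in>{0..w}. y * row y) = (\<Sum>s\<in>S. of_bool True * snd s)"
    by (rule sum_hits) (auto simp: finite_S dest: in_box')
  have l1: "(\<Sum>y\<in>{0..w}. y * dg (- y)) = (\<Sum>s\<in>S. of_bool (fst s \<le> snd s) * (snd s - fst s))"
    by (rule sum_hits) (auto simp: finite_S dest: in_box')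
  have l2: "(\<Sum>y\<in>{0..w}. y * ad y) = (\<Sum>s\<in>S. of_bool (fst s + snd s \<le> w) * (fst s + snd s))"
    by (rule sum_hits) (auto simp: finite_S dest: in_box')
  have r1: "(\<Sum>y\<in>{0..w}. y * dg (w - y)) = (\<Sum>s\<in>S. of_bool (snd s \<le> fst s) * (snd s - fst s + w))"
    by (rule sum_hits) (auto simp: finite_S dest: in_box')
  have r2: "(\<Sum>y\<in>{0..w}. y * ad (w + y)) = (\<Sum>s\<in>S. of_bool (w \<le> fst s + snd s) * (fst s + snd s - w))"
    by (rule sum_hits) (auto simp: finite_S dest: in_box')
  have "(\<Sum>s\<in>S. of_bool (fst s \<le> snd s) * (snd s - fst s)) + (\<Sum>s\<in>S. of_bool (fst s + snd s \<le> w) * (fst s + snd s))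
     + (\<Sum>s\<in>S. of_bool (snd s \<le> fst s) * (snd s - fst s + w)) + (\<Sum>s\<in>S. of_bool (w \<le> fst s + snd s) * (fst s + snd s - w))
     = (\<Sum>s\<in>S. 2 * snd s + w * of_bool (snd s \<le> fst s) - w * of_bool (w \<le> fst s + snd s) + w * of_bool (fst s + snd s = w))"
    unfolding sum.distrib[symmetric] by (intro sum.cong) (auto simp: of_bool_def)
  also have "\<dots> = 2 * (\<Sum>s\<in>S. snd s) + w * num (\<lambda>s. snd s \<le> fst s) - w * num (\<lambda>s. w \<le> fst s + snd s) + w * ad w"
    by (simp add: sum.distrib sum_subtractf sum_distrib_left[symmetric] hits_def)
  also have "\<dots> = 2 * (\<Sum>s\<in>S. snd s) + w"
    using count_dg count_ad by (simp add: ad_w)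
  finally show ?thesis
    using * unfolding q[OF left] q[OF right] c l1 l2 r1 r2 by simp
qed

text \<open>Since \<open>dg 0 = 1\<close>, the other three lines through a vacant cell of the main
  diagonal have 0 or 2 occupied members. At a queen all three are occupied and the indicator makes
  the total 4.\<close>

lemma diag_cell:
  assumes "i \<in> {0..w}"
  shows "even (col i + row i + ad (2 * i) + of_bool ((i, i) \<in> S))"
proof (cases "(i, i) \<in> S")
  case True
  then show ?thesis using queen_hits[OF True] by (simp flip: mult_2)
next
  case False
  then have "col i + row i + 1 + ad (2 * i) \<in> {0, 1, 3}"
    using cell[of i i] assms unfolding diff_self dg_0 mult_2 by simp
  then have "even (col i + row i + ad (2 * i))" by (rule even_of_cell) (rule hits_bounds)+
  then show ?thesis using False by simp
qed

lemma antidiag_cell: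
  assumes "i \<in> {0..w}"
  shows "even (col i + row (w - i) + dg (2 * i - w) + of_bool ((i, w - i) \<in> S))"
proof (cases "(i, w - i) \<in> S")
  case True
  moreover have "i - (w - i) = 2 * i - w" by simp
  ultimately show ?thesis using queen_hits[OF True] by simp
next
  case False
  moreover have "i - (w - i) = 2 * i - w" by simp
  ultimately have "col i + row (w - i) + 1 + dg (2 * i - w) \<in> {0, 1, 3}"
    using cell[of i "w - i"] assms by (simp add: ad_w) arith
  then have "even (col i + row (w - i) + dg (2 * i - w))" by (rule even_of_cell) (rule hits_bounds)+
  then show ?thesis using False by simp
qed

lemma sum_ad_even: "(\<Sum>i\<in>{0..w}. ad (2 * i)) = num (\<lambda>s. even (fst s + snd s))"
proof (rule sum_hits_1[where u = "\<lambda>s. (fst s + snd s) div 2"])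
  show "fst s + snd s = 2 * t \<longleftrightarrow> even (fst s + snd s) \<and> t = (fst s + snd s) div 2"
    for s :: "int \<times> int" and t by presburger
  show "(fst s + snd s) div 2 \<in> {0..w}" if "s \<in> S" for s
    using in_box'[OF that] by simp presburger
qed (simp_all add: finite_S)

text \<open>Sum \<open>diag_cell\<close> along the main diagonal: columns and rows give
  \<open>m\<close> each, the one queen there gives 1, and the antidiagonals crossing it in cells are
  those of even index.\<close>

lemma odd_num_even: "odd (num (\<lambda>s. even (fst s + snd s)))"
proof -
  obtain z where z: "(z, z) \<in> S" using dgE[OF dg_0] by force
  have zz: "(i, i) \<in> S \<longleftrightarrow> i = z" for i using same_dg[OF z, of i i] z by auto
  have e: "even (\<Sum>i\<in>{0..w}. col i + row i + ad (2 * i) + of_bool ((i, i) \<in> S))"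
    by (intro dvd_sum diag_cell)
  have one: "(\<Sum>i\<in>{0..w}. of_bool ((i, i) \<in> S) :: int) = 1"
    using in_box[OF z] by (simp add: zz of_bool_def)
  have "(\<Sum>i\<in>{0..w}. col i + row i + ad (2 * i) + of_bool ((i, i) \<in> S))
      = m + m + num (\<lambda>s. even (fst s + snd s)) + 1"
    unfolding sum.distrib sum_col sum_row one sum_ad_even by simp
  with e have "even (m + m + num (\<lambda>s. even (fst s + snd s)) + 1)" by (simp only:)
  then show ?thesis by presburger
qed

text \<open>For odd \<open>w\<close> the main antidiagonal is crossed in cells by the diagonals of
  odd index, so the argument of \<open>odd_num_even\<close> applies there to the queens of odd
  coordinate sum.\<close>

lemma even_w: "even w"
proof (rule ccontr)
  assume w: "odd w"
  obtain x y where "(x, y) \<in> S" "w = x + y" using adE[OF ad_w] .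
  then have z: "(x, w - x) \<in> S" by simp
  have zz: "(i, w - i) \<in> S \<longleftrightarrow> i = x" for i using same_ad[OF z, of i "w - i"] z by auto
  have e: "even (\<Sum>i\<in>{0..w}. col i + row (w - i) + dg (2 * i - w) + of_bool ((i, w - i) \<in> S))"
    by (intro dvd_sum antidiag_cell)
  have one: "(\<Sum>i\<in>{0..w}. of_bool ((i, w - i) \<in> S) :: int) = 1"
    using in_box[OF z] by (simp add: zz of_bool_def)
  have r: "(\<Sum>i\<in>{0..w}. row (w - i)) = num (\<lambda>s. True)"
    by (rule sum_hits_1[where u = "\<lambda>s. w - snd s"]) (auto simp: finite_S dest: in_box')
  have d: "(\<Sum>i\<in>{0..w}. dg (2 * i - w)) = num (\<lambda>s. odd (fst s + snd s))"
  proof (rule sum_hits_1[where u = "\<lambda>s. (fst s - snd s + w) div 2"])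
    show "fst s - snd s = 2 * t - w \<longleftrightarrow> odd (fst s + snd s) \<and> t = (fst s - snd s + w) div 2"
      for s :: "int \<times> int" and t using w by presburger
    show "(fst s - snd s + w) div 2 \<in> {0..w}" if "s \<in> S" for s
      using in_box'[OF that] by simp presburger
  qed (simp_all add: finite_S)
  have "(\<Sum>i\<in>{0..w}. col i + row (w - i) + dg (2 * i - w) + of_bool ((i, w - i) \<in> S))
      = m + m + num (\<lambda>s. odd (fst s + snd s)) + 1"
    unfolding sum.distrib sum_col r d one by simp
  with e have e': "even (m + m + num (\<lambda>s. odd (fst s + snd s)) + 1)" by (simp only:)
  have "num (\<lambda>s. even (fst s + snd s)) + num (\<lambda>s. odd (fst s + snd s)) = (\<Sum>s\<in>S. 1)"
    unfolding sum.distrib[symmetric] by (intro sum.cong) auto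
  then have s: "num (\<lambda>s. even (fst s + snd s)) + num (\<lambda>s. odd (fst s + snd s)) = m" by simp
  \<comment> \<open>Both parity classes of queens would have odd size, making \<open>m\<close> even,
    whereas \<open>count_dg\<close> makes \<open>m\<close> odd.\<close>
  show False
    by (rule parity_clash[OF e' s odd_num_even count_dg(1)])
qed

lemma of_bool_reflect:
  "(w - i = qt) = (i = qb)" "(w - i = qr) = (i = ql)" "(w - i = qb) = (i = qt)" "(w - i = ql) = (i = qr)"
  using qb_qt ql_qr by auto

text \<open>Add the bottom and left identities at \<open>i\<close> to the top and right ones at
  \<open>w - i\<close>. By \<open>qb_qt\<close> and \<open>ql_qr\<close> every term on the line side
  and every queen correction occurs twice, so the columns and rows drop out of
  \<open>diag_cell\<close> at the two mirror cells modulo 2.\<close>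

lemma ad_reflect_parity:
  assumes "i \<in> {0..w}"
  shows "even (ad (2 * i) + of_bool ((i, i) \<in> S)
    + (ad (2 * (w - i)) + of_bool ((w - i, w - i) \<in> S)))"
proof -
  have i': "w - i \<in> {0..w}" using assms by auto
  have eqs: "w - i - w = - i" "w - i + w = 2 * w - i" "w - (w - i) = i" "w + (w - i) = 2 * w - i"
    by simp_all
  have "col (w - i) + of_bool (i = qb) = dg (- i) + ad (2 * w - i)"
    using top_eq[OF i'] unfolding of_bool_reflect eqs .
  moreover have "row (w - i) + of_bool (i = ql) = dg i + ad (2 * w - i)"
    using right_eq[OF i'] unfolding of_bool_reflect eqs .
  ultimately have "col i + row i + col (w - i) + row (w - i)
      = 2 * (dg i + dg (- i) + ad i + ad (2 * w - i) - of_bool (i = qb) - of_bool (i = ql))"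
    using bottom_eq[OF assms] left_eq[OF assms] by simp
  then show ?thesis using diag_cell[OF assms] diag_cell[OF i'] by (rule parity_reflect)
qed

text \<open>The same cancellation on the main antidiagonal: right and top at \<open>i\<close>,
  bottom and left at \<open>w - i\<close>.\<close>

lemma dg_reflect_parity:
  assumes "i \<in> {0..w}"
  shows "even (dg (2 * i - w) + of_bool ((i, w - i) \<in> S)
    + (dg (2 * (w - i) - w) + of_bool ((w - i, i) \<in> S)))"
proof -
  have i': "w - i \<in> {0..w}" using assms by auto
  have "row i + of_bool (i = qr) = dg (w - i) + ad (w + i)"
    using right_eq[OF assms] .
  moreover have "col (w - i) + of_bool (i = qt) = dg (w - i) + ad (w - i)"
    using bottom_eq[OF i'] by (simp add: of_bool_reflect)
  moreover have "col i + of_bool (i = qt) = dg (i - w) + ad (w + i)"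
    using top_eq[OF assms] by (simp add: add.commute)
  moreover have "row (w - i) + of_bool (i = qr) = dg (i - w) + ad (w - i)"
    using left_eq[OF i'] by (simp add: of_bool_reflect)
  ultimately have "col i + row (w - i) + col (w - i) + row i
      = 2 * (dg (i - w) + dg (w - i) + ad (w + i) + ad (w - i) - of_bool (i = qt) - of_bool (i = qr))"
    by simp
  moreover have "even (col (w - i) + row i + dg (2 * (w - i) - w) + of_bool ((w - i, i) \<in> S))"
    using antidiag_cell[OF i'] by (simp only: diff_diff_eq2 add_diff_cancel_left')
  ultimately show ?thesis using antidiag_cell[OF assms] by (intro parity_reflect)
qed

end

section \<open>The central queen and the symmetry of even lines\<close>

locale queen_center = queen_square S w qb qt ql qr for S w qb qt ql qr +
  fixes c :: int
  assumes w_eq: "w = 2 * c"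
begin

lemma c_pos: "0 < c"
  using w_eq w_pos by simp

text \<open>The terms \<open>?f i\<close> of \<open>ad_reflect_parity\<close> have an even sum by
  \<open>odd_num_even\<close>, so their middle term is even too; as \<open>ad w = 1\<close>, it must
  include a queen at the centre.\<close>

lemma center: "(c, c) \<in> S"
proof -
  obtain z where z: "(z, z) \<in> S" using dgE[OF dg_0] by force
  have zz: "(i, i) \<in> S \<longleftrightarrow> i = z" for i using same_dg[OF z, of i i] z by auto
  let ?f = "\<lambda>i. ad (2 * i) + of_bool ((i, i) \<in> S)"
  have "even ((\<Sum>i\<in>{0..2 * c}. ?f i) + ?f c)"
    using c_pos by (intro even_sum_symmetric ad_reflect_parity[unfolded w_eq]) auto
  moreover have "(\<Sum>i\<in>{0..2 * c}. ?f i) = num (\<lambda>s. even (fst s + snd s)) + 1"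
    using sum_ad_even sum_of_bool_eq[of "{0..w}" z] in_box[OF z] unfolding w_eq[symmetric] sum.distrib zz
    by simp
  ultimately have "even (num (\<lambda>s. even (fst s + snd s)) + 1 + ?f c)" by (simp only:)
  then have "even (?f c)" using odd_num_even by (rule even_of_even_add)
  then show ?thesis using ad_w unfolding w_eq by (auto split: if_splits)
qed

lemma diag_center: "(i, i) \<in> S \<longleftrightarrow> i = c"
  using same_dg[OF center, of i i] center by auto
lemma antidiag_center: "(i, w - i) \<in> S \<longleftrightarrow> i = c"
  using same_ad[OF center, of i "w - i"] center w_eq by auto

text \<open>The only queen on the main diagonal is the centre, which is fixed by reflection, so the
  indicators in \<open>ad_reflect_parity\<close> cancel modulo 2.\<close>

lemma ad_even_reflect:
  assumes "x \<in> {0..w}" "even x"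
  shows "ad (2 * w - x) = ad x"
proof -
  obtain i where i: "x = 2 * i" using assms(2) by blast
  have "i \<in> {0..w}" using assms(1) i by auto
  moreover have "2 * (w - i) = 2 * w - x" "(w - i = c) = (i = c)" using i w_eq by auto
  ultimately have "even (ad x + of_bool (i = c) + (ad (2 * w - x) + of_bool (i = c)))"
    using ad_reflect_parity[of i] by (simp only: diag_center i)
  then show ?thesis using hits_bounds(7,8)[of x] hits_bounds(7,8)[of "2 * w - x"] by (rule eq_of_parity)
qed

lemma dg_even_reflect:
  assumes "x \<in> {0..w}" "even x"
  shows "dg (- x) = dg x"
proof -
  have "even (w + x)" using assms(2) even_w by simp
  then obtain i where i: "w + x = 2 * i" by blast
  have "i \<in> {0..w}" using assms(1) i w_eq by auto
  from dg_reflect_parity[OF this]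
  have "even (dg (2 * i - w) + of_bool (i = c) + (dg (2 * (w - i) - w) + of_bool (w - i = c)))"
    using antidiag_center[of i] antidiag_center[of "w - i"] by (simp only: diff_diff_eq2 add_diff_cancel_left')
  moreover have "2 * i - w = x" "2 * (w - i) - w = - x" "(w - i = c) = (i = c)" using i w_eq by auto
  ultimately have "even (dg x + of_bool (i = c) + (dg (- x) + of_bool (i = c)))" by (simp only:)
  then show ?thesis using hits_bounds(5,6)[of x] hits_bounds(5,6)[of "- x"] by (rule eq_of_parity)
qed

text \<open>If \<open>qb\<close> were even, symmetry would make both slanted lines through
  \<open>(0, qb)\<close> occupied, and the left identity would force \<open>qb = ql\<close>.
  Symmetrically for \<open>ql\<close>.\<close>

lemma odd_qb: "odd qb" and odd_ql: "odd ql"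
proof -
  have no: False if "qb = ql"
  proof -
    \<comment> \<open>The two queens would share an antidiagonal, hence coincide in the corner,
      which lies on the main diagonal together with the centre.\<close>
    have "qb = 0" "ql = 0" using same_ad[OF bottom left] that by auto
    then show False using bottom diag_center[of 0] c_pos by simp
  qed
  show "odd qb"
  proof
    assume e: "even qb"
    have "dg (- qb) = 1" "ad qb = 1"
      using dg_even_reflect[OF q_range(1) e] queen_hits(3,4)[OF bottom] by auto
    then have "qb = ql"
      using left_eq[OF q_range(1)] hits_bounds(4)[of qb] by (auto simp: of_bool_def split: if_splits)
    then show False by (rule no)
  qed
  show "odd ql"
  proof
    assume e: "even ql"
    have "dg ql = 1" "ad ql = 1"
      using dg_even_reflect[OF q_range(3) e] queen_hits(3,4)[OF left] by auto
    then have "ql = qb"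
      using bottom_eq[OF q_range(3)] hits_bounds(2)[of ql] by (auto simp: of_bool_def split: if_splits)
    then show False using no by simp
  qed
qed

lemma odd_qt: "odd qt" and odd_qr: "odd qr"
  using odd_qb odd_ql qb_qt ql_qr even_w by presburger+

text \<open>The side queens have odd positions, so the corrections vanish at even \<open>x\<close>,
  and the reflections turn the left and top identities into the bottom one.\<close>

lemma even_col:
  assumes "x \<in> {0..w}" "even x"
  shows "col x = dg x + ad x" "row x = dg x + ad x" "col (w - x) = col x"
proof -
  have "x \<noteq> qb" "x \<noteq> ql" "w - x \<noteq> qt" using assms odd_qb odd_ql odd_qt even_w by auto
  moreover have "w - x \<in> {0..w}" using assms by auto
  ultimately show "col x = dg x + ad x" "row x = dg x + ad x" "col (w - x) = col x"
    using bottom_eq[OF assms(1)] left_eq[OF assms(1)] top_eq[of "w - x"]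
      dg_even_reflect[OF assms] ad_even_reflect[OF assms] by (auto simp: algebra_simps)
qed

text \<open>Here \<open>col i = row i\<close>, so \<open>diag_cell\<close> leaves
  \<open>ad (2 * i)\<close> even, hence 0.\<close>

lemma ad_even_0:
  assumes "i \<in> {0..w}" "even i" "i \<noteq> c"
  shows "ad (2 * i) = 0"
proof -
  have "even (col i + row i + ad (2 * i))"
    using diag_cell[OF assms(1)] assms(3) by (simp add: diag_center)
  then show ?thesis
    using even_col[OF assms(1,2)] hits_bounds(7,8)[of "2 * i"] by (intro zero_of_even) auto
qed

lemma dg_even_0:
  assumes "i \<in> {0..w}" "even i" "i \<noteq> c"
  shows "dg (2 * i - w) = 0"
proof -
  have "w - i \<in> {0..w}" "even (w - i)" using assms even_w by auto
  then have "row (w - i) = col (w - i)" using even_col by simp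
  moreover have "even (col i + row (w - i) + dg (2 * i - w))"
    using antidiag_cell[OF assms(1)] assms(3) by (simp add: antidiag_center)
  ultimately show ?thesis
    using even_col[OF assms(1,2)] hits_bounds(5,6)[of "2 * i - w"] by (intro zero_of_even) auto
qed

lemma center_unique:
  "(c, y) \<in> S \<Longrightarrow> y = c" "(x, c) \<in> S \<Longrightarrow> x = c"
  "(x, y) \<in> S \<Longrightarrow> x = y \<Longrightarrow> x = c" "(x, y) \<in> S \<Longrightarrow> x + y = w \<Longrightarrow> x = c"
  subgoal by (rule same_col[OF _ center])
  subgoal by (rule same_row[OF _ center])
  subgoal using same_dg[OF _ center] by fastforce
  subgoal using same_ad[OF _ center] w_eq by fastforce
  done

section \<open>Excluding an even half side\<close>

lemma not_even_c: "odd c"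
proof
  assume c: "even c"
  \<comment> \<open>Otherwise the slanted lines of the queen cross the main diagonal at
    \<open>i\<close> and the main antidiagonal at \<open>j\<close>, both different from
    \<open>c\<close>. Then \<open>ad_even_0\<close> and \<open>dg_even_0\<close> make
    \<open>i\<close> and \<open>j\<close> odd, and \<open>x = i + j - c\<close> is even.\<close>
  have odd_col: "odd (x + y)" if s: "(x, y) \<in> S" "odd x" for x y
  proof
    assume e: "even (x + y)"
    have x: "x \<noteq> c" using s(2) c by auto
    obtain i where i: "x + y = 2 * i" using e by blast
    have "even (x - y + w)" using e even_w by simp
    then obtain j where j: "x - y + w = 2 * j" by blast
    have "i \<in> {0..w}" "j \<in> {0..w}" using in_box[OF s(1)] i j by auto
    moreover have "i \<noteq> c" using center_unique(4)[OF s(1)] i w_eq x by auto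
    moreover have "j \<noteq> c" using center_unique(3)[OF s(1)] j w_eq x by auto
    moreover have "2 * j - w = x - y" using j by simp
    then have "dg (2 * j - w) = 1" using queen_hits(3)[OF s(1)] by (simp only:)
    moreover have "ad (2 * i) = 1" using queen_hits(4)[OF s(1)] unfolding i .
    ultimately have "odd i" "odd j" using ad_even_0[of i] dg_even_0[of j] by auto
    moreover have "x = i + j - c" using i j w_eq by simp
    ultimately show False using s(2) c by simp
  qed
  let ?T = "{x \<in> {0..w}. odd x}"
  have T: "finite ?T" by (rule finite_subset[of _ "{0..w}"]) auto
  have b1: "(\<Sum>x\<in>?T. dg x) = num (\<lambda>s. odd (fst s + snd s) \<and> snd s \<le> fst s)"
  proof (rule sum_hits_1[OF finite_S T, where u = "\<lambda>s. fst s - snd s"], goal_cases)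
    case (1 s t)
    then have t: "0 \<le> t" "odd t" by simp_all
    show ?case
    proof
      assume eq: "fst s - snd s = t"
      then have "odd (fst s + snd s)" using t(2) even_w by presburger
      then show "(odd (fst s + snd s) \<and> snd s \<le> fst s) \<and> t = fst s - snd s" using t(1) eq by simp
    qed simp
  next
    case (2 s)
    then show ?case using in_box'[OF 2(1)] even_w by simp
  qed
  have b2: "(\<Sum>x\<in>?T. ad x) = num (\<lambda>s. odd (fst s + snd s) \<and> fst s + snd s \<le> w)"
  proof (rule sum_hits_1[OF finite_S T, where u = "\<lambda>s. fst s + snd s"], goal_cases)
    case (1 s t)
    then have t: "t \<le> w" "odd t" by simp_all
    show ?case
    proof
      assume eq: "fst s + snd s = t"
      then have "odd (fst s + snd s)" using t(2) even_w by presburger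
      then show "(odd (fst s + snd s) \<and> fst s + snd s \<le> w) \<and> t = fst s + snd s" using t(1) eq by simp
    qed simp
  next
    case (2 s)
    then show ?case using in_box'[OF 2(1)] even_w by simp
  qed
  have t1: "(\<Sum>x\<in>?T. dg (x - w)) = num (\<lambda>s. odd (fst s + snd s) \<and> fst s \<le> snd s)"
  proof (rule sum_hits_1[OF finite_S T, where u = "\<lambda>s. fst s - snd s + w"], goal_cases)
    case (1 s t)
    then have t: "t \<le> w" "odd t" by simp_all
    show ?case
    proof
      assume eq: "fst s - snd s = t - w"
      then have "odd (fst s + snd s)" using t(2) even_w by presburger
      then show "(odd (fst s + snd s) \<and> fst s \<le> snd s) \<and> t = fst s - snd s + w" using t(1) eq by simp
    qed simp
  next
    case (2 s)
    then show ?case using in_box'[OF 2(1)] even_w by simp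
  qed
  have t2: "(\<Sum>x\<in>?T. ad (x + w)) = num (\<lambda>s. odd (fst s + snd s) \<and> w \<le> fst s + snd s)"
  proof (rule sum_hits_1[OF finite_S T, where u = "\<lambda>s. fst s + snd s - w"], goal_cases)
    case (1 s t)
    then have t: "0 \<le> t" "odd t" by simp_all
    show ?case
    proof
      assume eq: "fst s + snd s = t + w"
      then have "odd (fst s + snd s)" using t(2) even_w by presburger
      then show "(odd (fst s + snd s) \<and> w \<le> fst s + snd s) \<and> t = fst s + snd s - w" using t(1) eq by simp
    qed simp
  next
    case (2 s)
    then show ?case using in_box'[OF 2(1)] even_w by simp
  qed
  have c1: "(\<Sum>x\<in>?T. col x) = num (\<lambda>s. odd (fst s))"
    by (rule sum_hits_1[OF finite_S T, where u = fst]) (auto dest: in_box')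
  have q: "(\<Sum>x\<in>?T. of_bool (x = qb) :: int) = 1" "(\<Sum>x\<in>?T. of_bool (x = qt) :: int) = 1"
    by (rule sum_of_bool_eq[OF T], use q_range odd_qb odd_qt in simp)+
  \<comment> \<open>Bottom and top identities are added over the odd columns, where both
    \<open>qb\<close> and \<open>qt\<close> lie; this accounts for the summand 2 below.\<close>
  have "(\<Sum>x\<in>?T. (col x + of_bool (x = qb)) + (col x + of_bool (x = qt)))
      = (\<Sum>x\<in>?T. (dg x + ad x) + (dg (x - w) + ad (x + w)))"
    by (intro sum.cong refl) (simp only: mem_Collect_eq bottom_eq top_eq)
  then have "2 * num (\<lambda>s. odd (fst s)) + 2
      = num (\<lambda>s. odd (fst s + snd s) \<and> snd s \<le> fst s) + num (\<lambda>s. odd (fst s + snd s) \<and> fst s + snd s \<le> w)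
      + num (\<lambda>s. odd (fst s + snd s) \<and> fst s \<le> snd s) + num (\<lambda>s. odd (fst s + snd s) \<and> w \<le> fst s + snd s)"
    unfolding sum.distrib b1 b2 t1 t2 c1 q by linarith
  \<comment> \<open>As \<open>w\<close> is even, a queen of odd coordinate sum is on neither main
    diagonal, so each of its slanted lines meets exactly one of the two sides.\<close>
  also have "\<dots> = (\<Sum>s\<in>S. 2 * of_bool (odd (fst s + snd s)))"
    unfolding sum.distrib[symmetric]
  proof (rule sum.cong[OF refl], goal_cases)
    case (1 s)
    show ?case
    proof (cases "odd (fst s + snd s)")
      case True
      then have "fst s \<noteq> snd s" "fst s + snd s \<noteq> w" using even_w by auto
      then show ?thesis using True by (cases "fst s < snd s"; cases "fst s + snd s < w") simp_all
    qed simp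
  qed
  finally have eq: "num (\<lambda>s. odd (fst s)) + 1 = num (\<lambda>s. odd (fst s + snd s))"
    unfolding sum_distrib_left[symmetric] by linarith
  txt \<open>The left and right queens lie in even columns but on odd diagonals.\<close>
  have "(\<Sum>s\<in>S. of_bool (odd (fst s)) + (of_bool (s = (0, ql)) + of_bool (s = (w, qr))) :: int)
      \<le> num (\<lambda>s. odd (fst s + snd s))"
  proof (intro sum_mono, goal_cases)
    case (1 s)
    obtain x y where s: "s = (x, y)" by fastforce
    show ?case
    proof (cases "odd x")
      case True
      then have "odd (x + y)" "x \<noteq> 0" "x \<noteq> w" using odd_col[of x y] 1 even_w s by auto
      then show ?thesis by (simp add: s)
    next
      case False
      then show ?thesis using odd_ql odd_qr w_pos by (auto simp: s)
    qed
  qed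
  moreover have "(\<Sum>s\<in>S. of_bool (s = (0, ql)) :: int) = 1" "(\<Sum>s\<in>S. of_bool (s = (w, qr)) :: int) = 1"
    by (rule sum_of_bool_eq[OF finite_S left], rule sum_of_bool_eq[OF finite_S right])
  ultimately show False unfolding sum.distrib using eq by linarith
qed

section \<open>Odd half side: divisibility by 4 and the contradiction\<close>

lemma ad_4_0:
  assumes "0 \<le> k" "k \<le> 2 * w" "4 dvd k"
  shows "ad k = 0"
proof -
  obtain j where j: "k = 4 * j" using assms(3) by blast
  moreover have "2 * j \<noteq> c" using not_even_c by (metis dvd_triv_left)
  ultimately show ?thesis using ad_even_0[of "2 * j"] assms by auto
qed

text \<open>Both \<open>k\<close> and \<open>w\<close> are 2 modulo 4, so \<open>k + w\<close> is
  twice an even number, which differs from the odd \<open>c\<close>.\<close>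

lemma dg_2_0:
  assumes "0 \<le> k" "k \<le> w" "even k" "\<not> 4 dvd k"
  shows "dg k = 0"
proof -
  have "even ((k + w) div 2)" "k + w = 2 * ((k + w) div 2)" "(k + w) div 2 \<noteq> c"
    using assms not_even_c w_eq by presburger+
  then show ?thesis using dg_even_0[of "(k + w) div 2"] assms by auto
qed

text \<open>At the cell \<open>(k + e, e)\<close> the row and the diagonal are occupied and the
  antidiagonal, of index divisible by 4, is not. Two occupied lines are forbidden, so column
  \<open>k + e\<close> is occupied, and at multiples of 4 columns agree with diagonals.\<close>

lemma dg_4_add:
  assumes e: "0 \<le> e" "4 dvd e" "dg e = 1" and k: "0 \<le> k" "4 dvd k" "dg k = 1" and le: "k + e \<le> w"
  shows "dg (k + e) = 1"
proof -
  have sub: "col x = dg x" "row x = dg x" if "0 \<le> x" "x \<le> w" "4 dvd x" for x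
  proof -
    have "even x" using that(3) by presburger
    then show "col x = dg x" "row x = dg x" using even_col[of x] ad_4_0[of x] that by auto
  qed
  have a: "ad (k + e + e) = 0" using assms by (intro ad_4_0) auto
  then have "(k + e, e) \<notin> S" using queen_hits(4)[of "k + e" e] by auto
  then have "col (k + e) + row e + dg (k + e - e) + ad (k + e + e) \<in> {0, 1, 3}"
    using assms by (intro cell) auto
  moreover have "k + e - e = k" by simp
  moreover have "row e = 1" using sub(2)[of e] e k le by simp
  ultimately have "col (k + e) + 1 + 1 + 0 \<in> {0, 1, 3}" by (simp only: a k(3))
  then have "col (k + e) = 1" using hits_bounds(1)[of "k + e"] by auto
  then show ?thesis using sub[of "k + e"] e k le by simp
qed

text \<open>Take the largest occupied index \<open>M\<close>. The antidiagonal of its queen yields a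
  further occupied index \<open>w - k\<close>; closure under addition and maximality force
  \<open>w - k = 0\<close>, so the queen is the centre, against \<open>0 < M\<close>.\<close>

lemma dg_4_0:
  assumes "0 < k" "k \<le> w" "4 dvd k"
  shows "dg k = 0"
proof (rule ccontr)
  assume "dg k \<noteq> 0"
  then have k1: "dg k = 1" using hits_bounds(5,6)[of k] by linarith
  define E where "E = {e \<in> {0..w}. 4 dvd e \<and> dg e = 1}"
  define M where "M = Max E"
  have fin: "finite E" unfolding E_def by (rule finite_subset[of _ "{0..w}"]) auto
  have "k \<in> E" using k1 assms by (simp add: E_def)
  then have "M \<in> E" "k \<le> M" using fin by (auto simp: M_def intro: Max_in)
  then have M: "0 < M" "M \<le> w" "4 dvd M" "dg M = 1" using assms(1) by (auto simp: E_def)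
  obtain x y where s: "(x, y) \<in> S" "M = x - y" using dgE[OF M(4)] .
  note box = in_box[OF s(1)]
  \<comment> \<open>The antidiagonal index of the queen, reflected to at most \<open>w\<close>;
    \<open>ad_even_reflect\<close> keeps it occupied.\<close>
  define k where "k = (if x + y \<le> w then x + y else 2 * w - (x + y))"
  have even_xy: "even (x + y)" using M(3) s(2) by presburger
  then have k: "0 \<le> k" "k \<le> w" "even k" using box by (auto simp: k_def)
  have "ad (x + y) = 1" using queen_hits[OF s(1)] by simp
  then have ad_k: "ad k = 1"
    using ad_even_reflect[OF _ k(3)] k(1,2) by (auto simp: k_def split: if_splits)
  have not4: "\<not> 4 dvd k" using ad_k ad_4_0[of k] k by auto
  then have "col k = 1" using even_col(1)[of k] k dg_2_0[of k] ad_k by simp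
  then have "col (w - k) = 1" using even_col(3)[of k] k by simp
  moreover have wk: "4 dvd w - k" using not4 k(3) w_eq not_even_c by presburger
  then have "even (w - k)" by presburger
  ultimately have "dg (w - k) = 1"
    using even_col(1)[of "w - k"] ad_4_0[of "w - k"] wk k by simp
  \<comment> \<open>In the box, \<open>x - y\<close> is at most both \<open>x + y\<close> and
    \<open>2 * w - (x + y)\<close>, hence at most \<open>k\<close>.\<close>
  moreover have le: "M + (w - k) \<le> w" using box s(2) by (auto simp: k_def)
  ultimately have "dg (M + (w - k)) = 1"
    using M k wk by (intro dg_4_add) auto
  then have "M + (w - k) \<in> E" using M k wk le by (simp add: E_def)
  then have "M + (w - k) \<le> M" using Max_ge[OF fin] unfolding M_def by blast
  then have "k = w" using k by simp
  then have "x + y = w" by (auto simp: k_def split: if_splits)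
  then show False using center_unique(4)[OF s(1)] s(2) M(1) w_eq by simp
qed

lemma dg_even_pos: "0 < k \<Longrightarrow> k \<le> w \<Longrightarrow> even k \<Longrightarrow> dg k = 0"
  using dg_4_0[of k] dg_2_0[of k] by (cases "4 dvd k") auto

text \<open>Since \<open>w\<close> is 2 modulo 4, one of \<open>x\<close> and \<open>w - x\<close>
  is a multiple of 4, and their columns agree. At a positive multiple of 4 both slanted terms of
  \<open>even_col\<close> vanish.\<close>

lemma even_col_boundary:
  assumes "0 \<le> x" "x \<le> w" "even x" "col x = 1"
  shows "x = 0 \<or> x = w"
proof (rule ccontr)
  assume x: "\<not> ?thesis"
  then have "4 dvd x \<or> 4 dvd w - x" using assms(3) w_eq not_even_c by presburger
  moreover have "\<not> 4 dvd x"
    using even_col(1)[of x] ad_4_0[of x] dg_even_pos[of x] x assms by auto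
  moreover have "\<not> 4 dvd w - x"
    using even_col(1)[of "w - x"] even_col(3)[of x] ad_4_0[of "w - x"] dg_even_pos[of "w - x"]
      x assms even_w by auto
  ultimately show False by blast
qed

text \<open>One coordinate is even. An even row has the value of the column of the same index, so
  \<open>even_col_boundary\<close> covers both cases.\<close>

lemma odd_boundary:
  assumes "(x, y) \<in> S" "odd (x + y)"
  shows "x = 0 \<or> x = w \<or> y = 0 \<or> y = w"
proof -
  have "row y = col y" if "even y" using even_col(1,2)[of y] that in_box[OF assms(1)] by simp
  then have "col y = 1" if "even y" using that queen_hits(2)[OF assms(1)] by simp
  moreover have "even x \<or> even y" using assms(2) by auto
  ultimately show ?thesis
    using even_col_boundary[of x] even_col_boundary[of y] in_box[OF assms(1)] queen_hits(1)[OF assms(1)]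
    by blast
qed

text \<open>Column \<open>c\<close> is occupied by the centre, so the bottom identity at
  \<open>c\<close> demands a queen on a slanted line through \<open>(c, 0)\<close>. Its coordinate
  sum is odd, which puts it on a side of the box.\<close>

lemma inconsistent: False
proof -
  have "c \<noteq> qb" using center_unique(1)[of 0] bottom c_pos by auto
  then have "dg c + ad c = 1"
    using bottom_eq[of c] queen_hits(1)[OF center] c_pos w_eq by simp
  then have "dg c = 1 \<or> ad c = 1" using hits_bounds(5-8)[of c] by arith
  then have "\<exists>x y. (x, y) \<in> S \<and> (c = x - y \<or> c = x + y)"
  proof (elim disjE)
    assume "dg c = 1"
    then obtain x y where "(x, y) \<in> S" "c = x - y" by (rule dgE)
    then show ?thesis by (intro exI conjI disjI1)
  next
    assume "ad c = 1"
    then obtain x y where "(x, y) \<in> S" "c = x + y" by (rule adE)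
    then show ?thesis by (intro exI conjI disjI2)
  qed
  then obtain x y where s: "(x, y) \<in> S" "c = x - y \<or> c = x + y" by blast
  note box = in_box[OF s(1)]
  have "odd (x + y)" using s(2) not_even_c by presburger
  then have "x = 0 \<or> x = w \<or> y = 0 \<or> y = w" by (rule odd_boundary[OF s(1)])
  \<comment> \<open>The two lines meet the sides only in \<open>(c, 0)\<close>,
    \<open>(0, c)\<close> and \<open>(w, c)\<close>, all in the middle column or row.\<close>
  then have "x = c \<or> y = c" using s(2) box c_pos w_eq
    by (elim disjE) ((rule disjI1, linarith) | (rule disjI2, linarith))+
  then have "x = c \<and> y = c" using s(1) center_unique(1)[of y] center_unique(2)[of x] by blast
  then show False using s(2) c_pos by simp
qed

end

section \<open>From odd independent sets to bounding boxes\<close>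

lemma not_queen_square: "\<not> queen_square S w qb qt ql qr"
proof
  assume "queen_square S w qb qt ql qr"
  then interpret queen_square S w qb qt ql qr .
  interpret queen_center S w qb qt ql qr "w div 2"
    by unfold_locales (use even_w in simp)
  show False by (rule inconsistent)
qed

lemma (in queen_box) box_trivial: "w = 0" "h = 0"
proof -
  have "\<not> 0 < w"
  proof
    assume "0 < w"
    then have "queen_square S w qb qt ql qr"
      using queen_box_axioms w_eq_h by (simp add: queen_square_def queen_square_axioms_def)
    then show False using not_queen_square by blast
  qed
  then show "w = 0" "h = 0" using w_nonneg w_eq_h by simp_all
qed

text \<open>Distinct cells share at most one line, so the adjacency indicator is additive over the
  four families.\<close>

lemma queen_adj_count:
  assumes "s \<noteq> v"
  shows "(of_bool (queen_adj v s) :: int) = of_bool (fst s = fst v) + of_bool (snd s = snd v)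
    + of_bool (fst s - snd s = fst v - snd v) + of_bool (fst s + snd s = fst v + snd v)"
proof -
  obtain a b where s: "s = (a, b)" by fastforce
  obtain a' b' where v: "v = (a', b')" by fastforce
  show ?thesis
  proof (cases "a = a' \<or> b = b'")
    case True
    then show ?thesis using assms by (auto simp: s v queen_adj_def)
  next
    case False
    then have "(a' - a = b' - b) = (a - b = a' - b')" "(a' - a = b - b') = (a + b = a' + b')"
      "\<not> (a - b = a' - b' \<and> a + b = a' + b')" by linarith+
    then show ?thesis using False by (auto simp: s v queen_adj_def)
  qed
qed

lemma card_nbhd_queens:
  assumes "finite S" "S \<subseteq> B" "v \<in> B" "v \<notin> S"
  shows "int (card (nbhd (queen_graph B) v \<inter> S)) = hits S fst (fst v) + hits S snd (snd v)
    + hits S (\<lambda>s. fst s - snd s) (fst v - snd v) + hits S (\<lambda>s. fst s + snd s) (fst v + snd v)"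
proof -
  have "nbhd (queen_graph B) v \<inter> S = {s \<in> S. queen_adj v s}"
    using assms by (auto simp: nbhd_def queen_graph_def)
  then have "int (card (nbhd (queen_graph B) v \<inter> S)) = (\<Sum>s\<in>S. of_bool (queen_adj v s))"
    using assms(1) by (simp add: Int_def)
  also have "\<dots> = (\<Sum>s\<in>S. of_bool (fst s = fst v) + of_bool (snd s = snd v)
    + of_bool (fst s - snd s = fst v - snd v) + of_bool (fst s + snd s = fst v + snd v))"
    using assms(4) by (intro sum.cong refl queen_adj_count) auto
  finally show ?thesis by (simp only: hits_def sum.distrib)
qed

text \<open>Serves to move the lower left corner of the bounding box to the origin.\<close>

lemma hits_translate:
  "hits ((\<lambda>s. (fst s - a, snd s - b)) ` S) fst t = hits S fst (t + a)"
  "hits ((\<lambda>s. (fst s - a, snd s - b)) ` S) snd t = hits S snd (t + b)"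
  "hits ((\<lambda>s. (fst s - a, snd s - b)) ` S) (\<lambda>s. fst s - snd s) t = hits S (\<lambda>s. fst s - snd s) (t + (a - b))"
  "hits ((\<lambda>s. (fst s - a, snd s - b)) ` S) (\<lambda>s. fst s + snd s) t = hits S (\<lambda>s. fst s + snd s) (t + (a + b))"
proof -
  have inj: "inj_on (\<lambda>s. (fst s - a, snd s - b)) S" by (auto simp: inj_on_def prod_eq_iff)
  show "hits ((\<lambda>s. (fst s - a, snd s - b)) ` S) fst t = hits S fst (t + a)"
    "hits ((\<lambda>s. (fst s - a, snd s - b)) ` S) snd t = hits S snd (t + b)"
    "hits ((\<lambda>s. (fst s - a, snd s - b)) ` S) (\<lambda>s. fst s - snd s) t = hits S (\<lambda>s. fst s - snd s) (t + (a - b))"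
    "hits ((\<lambda>s. (fst s - a, snd s - b)) ` S) (\<lambda>s. fst s + snd s) t = hits S (\<lambda>s. fst s + snd s) (t + (a + b))"
    unfolding hits_def sum.reindex[OF inj] o_def
    by (intro sum.cong arg_cong[where f = of_bool]; auto)+
qed

lemma independent_queens_inj:
  assumes "independent_set (queen_graph B) S"
  shows "inj_on fst S" "inj_on snd S" "inj_on (\<lambda>s. fst s - snd s) S" "inj_on (\<lambda>s. fst s + snd s) S"
proof -
  have *: "\<not> queen_adj s t" if "s \<in> S" "t \<in> S" for s t
    using assms that by (auto simp: independent_set_def queen_graph_def)
  have **: "s = t" if "s \<in> S" "t \<in> S" "fst s = fst t \<or> snd s = snd t
      \<or> fst s - snd s = fst t - snd t \<or> fst s + snd s = fst t + snd t" for s t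
  proof (rule ccontr)
    assume "s \<noteq> t"
    then show False
      using queen_adj_count[of s t] *[OF that(2,1)] that(3) by (auto simp: of_bool_def split: if_splits)
  qed
  show "inj_on fst S" "inj_on snd S" "inj_on (\<lambda>s. fst s - snd s) S" "inj_on (\<lambda>s. fst s + snd s) S"
    by (rule inj_onI, rule **; blast)+
qed

lemma inj_on_image_shift:
  fixes g :: "'a \<Rightarrow> int"
  assumes "inj_on g S" "\<And>s. g (f s) = g s - k"
  shows "inj_on g (f ` S)"
proof (rule inj_onI, elim imageE)
  fix x y s t
  assume "g x = g y" "x = f s" "s \<in> S" "y = f t" "t \<in> S"
  moreover from this have "g s = g t" using assms(2)[of s] assms(2)[of t] by simp
  ultimately show "x = y" using inj_onD[OF assms(1)] by blast
qed

text \<open>The conditions on \<open>I\<close> and \<open>J\<close> keep the whole bounding box on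
  the board, so the odd condition is available at each of its vacant cells. Squares, the quadrant
  and the plane are all of this form.\<close>

lemma card_odd_independent_queens_le_1:
  fixes I J :: "int set"
  assumes S: "odd_independent_set (queen_graph (I \<times> J)) S" and fin: "finite S"
    and I: "\<And>x y. x \<in> I \<Longrightarrow> y \<in> I \<Longrightarrow> {x..y} \<subseteq> I"
    and J: "\<And>x y. x \<in> J \<Longrightarrow> y \<in> J \<Longrightarrow> {x..y} \<subseteq> J"
  shows "card S \<le> 1"
proof (cases "S = {}")
  case False
  have ind: "independent_set (queen_graph (I \<times> J)) S"
    using S by (simp add: odd_independent_set_def)
  then have sub: "S \<subseteq> I \<times> J" by (simp add: independent_set_def queen_graph_def)
  note inj = independent_queens_inj[OF ind]
  define x0 x1 y0 y1 where
    "x0 = Min (fst ` S)" and "x1 = Max (fst ` S)" and "y0 = Min (snd ` S)" and "y1 = Max (snd ` S)"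
  have "x0 \<in> fst ` S" "x1 \<in> fst ` S" "y0 \<in> snd ` S" "y1 \<in> snd ` S"
    unfolding x0_def x1_def y0_def y1_def using fin False by simp_all
  then obtain ql qr qb qt where q: "(x0, ql) \<in> S" "(x1, qr) \<in> S" "(qb, y0) \<in> S" "(qt, y1) \<in> S"
    by force
  have box: "x0 \<le> fst s \<and> fst s \<le> x1 \<and> y0 \<le> snd s \<and> snd s \<le> y1" if "s \<in> S" for s
    unfolding x0_def x1_def y0_def y1_def using fin that by simp
  let ?f = "\<lambda>s. (fst s - x0, snd s - y0)"
  have img: "(x, y) \<in> ?f ` S \<longleftrightarrow> (x + x0, y + y0) \<in> S" for x y
  proof
    assume "(x, y) \<in> ?f ` S"
    then obtain s where "s \<in> S" "x = fst s - x0" "y = snd s - y0" by auto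
    then show "(x + x0, y + y0) \<in> S" by simp
  next
    assume "(x + x0, y + y0) \<in> S"
    then show "(x, y) \<in> ?f ` S" by (rule rev_image_eqI) simp
  qed
  interpret queen_box "?f ` S" "x1 - x0" "y1 - y0" "qb - x0" "qt - x0" "ql - y0" "qr - y0"
  proof
    show "finite (?f ` S)" using fin by simp
    show "0 \<le> x \<and> x \<le> x1 - x0 \<and> 0 \<le> y \<and> y \<le> y1 - y0" if "(x, y) \<in> ?f ` S" for x y
      using that box[of "(x + x0, y + y0)"] unfolding img by simp
    show "inj_on fst (?f ` S)" "inj_on snd (?f ` S)"
      "inj_on (\<lambda>s. fst s - snd s) (?f ` S)" "inj_on (\<lambda>s. fst s + snd s) (?f ` S)"
      by (rule inj_on_image_shift[OF inj(1)], simp, rule inj_on_image_shift[OF inj(2)], simp,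
          rule inj_on_image_shift[OF inj(3), where k = "x0 - y0"], simp,
          rule inj_on_image_shift[OF inj(4), where k = "x0 + y0"], simp)
    show "(qb - x0, 0) \<in> ?f ` S" "(qt - x0, y1 - y0) \<in> ?f ` S"
      "(0, ql - y0) \<in> ?f ` S" "(x1 - x0, qr - y0) \<in> ?f ` S"
      unfolding img using q by simp_all
  next
    fix x y
    assume xy: "0 \<le> x" "x \<le> x1 - x0" "0 \<le> y" "y \<le> y1 - y0" "(x, y) \<notin> ?f ` S"
    define v where "v = (x + x0, y + y0)"
    have "v \<notin> S" using xy(5) unfolding img v_def .
    moreover have "x0 \<in> I" "x1 \<in> I" "y0 \<in> J" "y1 \<in> J" using q sub by auto
    then have "{x0..x1} \<subseteq> I" "{y0..y1} \<subseteq> J" by (simp_all add: I J)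
    then have "x + x0 \<in> I" "y + y0 \<in> J" using xy(1-4) by (simp_all add: subset_eq)
    ultimately have v: "v \<in> I \<times> J" "v \<notin> S" by (simp_all add: v_def)
    let ?n = "hits (?f ` S) fst x + hits (?f ` S) snd y
      + hits (?f ` S) (\<lambda>s. fst s - snd s) (x - y) + hits (?f ` S) (\<lambda>s. fst s + snd s) (x + y)"
    have n: "?n = int (card (nbhd (queen_graph (I \<times> J)) v \<inter> S))"
      unfolding hits_translate card_nbhd_queens[OF fin sub v] by (simp add: v_def algebra_simps)
    have "nbhd (queen_graph (I \<times> J)) v \<inter> S = {} \<or> odd (card (nbhd (queen_graph (I \<times> J)) v \<inter> S))"
      using S v by (simp add: odd_independent_set_def queen_graph_def)
    then have "?n = 0 \<or> odd ?n" unfolding n by auto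
    moreover have "0 \<le> ?n" unfolding n by simp
    moreover have "?n \<le> 4"
      unfolding hits_translate hits_eq_of_bool[OF fin inj(1)] hits_eq_of_bool[OF fin inj(2)]
        hits_eq_of_bool[OF fin inj(3)] hits_eq_of_bool[OF fin inj(4)] of_bool_def by simp
    ultimately show "?n \<in> {0, 1, 3}" by (rule zero_or_odd_le_4)
  qed
  have "S \<subseteq> {(x0, y0)}"
  proof
    fix s assume "s \<in> S"
    from box[OF this] show "s \<in> {(x0, y0)}" using box_trivial by (simp add: prod_eq_iff)
  qed
  then show ?thesis using card_mono[of "{(x0, y0)}" S] by simp
qed simp

section \<open>Independence number and colorings\<close>

lemma odd_independent_singleton:
  assumes "v \<in> B"
  shows "odd_independent_set (queen_graph B) {v}"
  using assms
  by (auto simp: odd_independent_set_def independent_set_def queen_graph_def queen_adj_def)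

lemma odd_independent_color_class:
  assumes "strong_odd_coloring (queen_graph B) c"
  shows "odd_independent_set (queen_graph B) {v \<in> B. c v = k}"
proof -
  have verts: "verts (queen_graph B) = B" by (simp add: queen_graph_def)
  have color_class: "nbhd (queen_graph B) v \<inter> {u \<in> B. c u = k} = {u \<in> nbhd (queen_graph B) v. c u = k}" for v
    by (auto simp: nbhd_def verts)
  show ?thesis
    unfolding odd_independent_set_def independent_set_def verts color_class
  proof (intro conjI ballI)
    fix u v assume "u \<in> {v \<in> B. c v = k}" "v \<in> {v \<in> B. c v = k}"
    then have "u \<in> B" "v \<in> B" "c u = c v" by simp_all
    then show "\<not> adj (queen_graph B) u v"
      using assms unfolding strong_odd_coloring_def proper_coloring_def verts by blast
  next
    fix v assume "v \<in> B - {v \<in> B. c v = k}"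
    then have "\<forall>k \<in> c ` nbhd (queen_graph B) v. odd (card {u \<in> nbhd (queen_graph B) v. c u = k})"
      using assms unfolding strong_odd_coloring_def verts by blast
    then show "{u \<in> nbhd (queen_graph B) v. c u = k} = {}
        \<or> odd (card {u \<in> nbhd (queen_graph B) v. c u = k})"
      by blast
  qed blast
qed

text \<open>Each color in a neighborhood occurs exactly once; this gives the upper bound for the
  chromatic number.\<close>

lemma strong_odd_coloring_if_inj:
  assumes "inj_on c B"
  shows "strong_odd_coloring (queen_graph B) c"
  unfolding strong_odd_coloring_def proper_coloring_def
proof (intro conjI ballI impI)
  fix u v assume "adj (queen_graph B) u v"
  then show "c u \<noteq> c v" using assms by (auto simp: queen_graph_def queen_adj_def inj_on_def)
next
  fix v k assume "k \<in> c ` nbhd (queen_graph B) v"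
  then obtain u where u: "u \<in> nbhd (queen_graph B) v" "k = c u" by blast
  have "nbhd (queen_graph B) v \<subseteq> B" by (auto simp: nbhd_def queen_graph_def)
  then have "{u \<in> nbhd (queen_graph B) v. c u = k} = {u}"
    using u assms by (auto simp: inj_on_def)
  then show "odd (card {u \<in> nbhd (queen_graph B) v. c u = k})" by simp
qed

lemma card_odd_independent_square_le_1:
  assumes "odd_independent_set (queen_graph (square_board n)) S"
  shows "card S \<le> 1"
proof -
  have "S \<subseteq> square_board n"
    using assms by (simp add: odd_independent_set_def independent_set_def queen_graph_def)
  then have "finite S" by (rule finite_subset) (simp add: square_board_def)
  then show ?thesis
    using assms unfolding square_board_def by (intro card_odd_independent_queens_le_1) auto
qed

lemma odd_independence_number_square:
  assumes "n \<ge> 1"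
  shows "odd_independence_number (queen_graph (square_board n)) = 1"
  unfolding odd_independence_number_def
proof (rule Max_eqI)
  let ?A = "{card S | S. odd_independent_set (queen_graph (square_board n)) S}"
  have "?A \<subseteq> {..1}" using card_odd_independent_square_le_1 by auto
  then show "finite ?A" by (rule finite_subset) simp
  show "k \<le> 1" if "k \<in> ?A" for k using that card_odd_independent_square_le_1 by auto
  have "odd_independent_set (queen_graph (square_board n)) {(1, 1)}"
    using assms by (intro odd_independent_singleton) (simp add: square_board_def)
  then show "1 \<in> ?A" by (intro CollectI exI[of _ "{(1, 1)}"]) simp
qed

lemma strong_odd_chromatic_number_square:
  "strong_odd_chromatic_number (queen_graph (square_board n)) = n\<^sup>2"
  unfolding strong_odd_chromatic_number_def
proof (rule Least_equality)
  let ?B = "square_board n"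
  have fin: "finite ?B" and card: "card ?B = n\<^sup>2"
    by (simp_all add: square_board_def power2_eq_square)
  have verts: "verts (queen_graph ?B) = ?B" by (simp add: queen_graph_def)
  obtain c :: "int \<times> int \<Rightarrow> nat" where "bij_betw c ?B {..<n\<^sup>2}"
    using ex_bij_betw_finite_nat[OF fin] unfolding card atLeast0LessThan by blast
  then show "\<exists>c :: int \<times> int \<Rightarrow> nat. c ` verts (queen_graph ?B) \<subseteq> {..<n\<^sup>2}
      \<and> strong_odd_coloring (queen_graph ?B) c"
    unfolding verts bij_betw_def by (intro exI[of _ c] conjI strong_odd_coloring_if_inj) auto
  fix k
  assume "\<exists>c :: int \<times> int \<Rightarrow> nat. c ` verts (queen_graph ?B) \<subseteq> {..<k}
      \<and> strong_odd_coloring (queen_graph ?B) c"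
  then obtain c :: "int \<times> int \<Rightarrow> nat"
    where c: "c ` ?B \<subseteq> {..<k}" "strong_odd_coloring (queen_graph ?B) c"
    unfolding verts by blast
  \<comment> \<open>Color classes are odd independent sets, so each contains at most one cell; this
    gives the lower bound.\<close>
  have "inj_on c ?B"
  proof (rule inj_onI)
    fix u v assume uv: "u \<in> ?B" "v \<in> ?B" "c u = c v"
    let ?K = "{x \<in> ?B. c x = c v}"
    have "card ?K \<le> 1" "finite ?K"
      using card_odd_independent_square_le_1[OF odd_independent_color_class[OF c(2)]] fin by simp_all
    then have "\<forall>a\<in>?K. \<forall>b\<in>?K. a = b" unfolding One_nat_def by (simp only: card_le_Suc0_iff_eq)
    then show "u = v" using uv by blast
  qed
  then show "n\<^sup>2 \<le> k"
    using card_inj_on_le[OF _ c(1)] by (simp add: card)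
qed

lemma empty_singleton_or_infinite:
  assumes "finite S \<Longrightarrow> card S \<le> 1"
  shows "S = {} \<or> (\<exists>v. S = {v}) \<or> infinite S"
  using assms by (metis One_nat_def card_1_singletonE card_0_eq le_SucE le_zero_eq)

theorem corollary7:
  shows "(\<forall>n::nat. n \<ge> 1 \<longrightarrow> odd_independence_number (queen_graph (square_board n)) = 1)
    \<and> (\<forall>n::nat. n \<ge> 1 \<longrightarrow> strong_odd_chromatic_number (queen_graph (square_board n)) = n\<^sup>2)
    \<and> (\<forall>S. odd_independent_set (queen_graph ({1..} \<times> {1..})) S
          \<longrightarrow> S = {} \<or> (\<exists>v. S = {v}) \<or> infinite S)
    \<and> (\<forall>S. odd_independent_set (queen_graph UNIV) S
          \<longrightarrow> S = {} \<or> (\<exists>v. S = {v}) \<or> infinite S)"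
  using odd_independence_number_square strong_odd_chromatic_number_square
    empty_singleton_or_infinite[OF card_odd_independent_queens_le_1[of "{1..}" "{1..}"]]
    empty_singleton_or_infinite[OF card_odd_independent_queens_le_1[of UNIV UNIV]]
  by auto

end
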